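(* Let $d\ge 3$ be fixed and let $C=[C_{i_1,\ldots,i_d}]$, $(i_1,\ldots,i_d)\in[n]^d$, have independent entries, each exponentially distributed with mean $1$. Let $Z^{(d)}_P$ be the minimum of $C(T)=\sum_{(i_1,\ldots,i_d)\in T}C_{i_1,\ldots,i_d}$ over all $d$-dimensional planar assignments $T$. Then with high probability (i.e. with probability tending to $1$ as $n\to\infty$) $$\Omega\!\left(\frac{1}{n^{d-2}}\right)\le Z^{(d)}_P\le O\!\left(\frac{\log n}{n^{d-2}}\right).$$
   Context: A $d$-dimensional planar assignment is a set $T$ of $n$ $d$-tuples $(i_{1,t},\ldots,i_{d,t})$, $t=1,\ldots,n$, such that for each coordinate $r\in[d]$ we have $\{i_{r,1},\ldots,i_{r,n}\}=[n]$; equivalently, each of the $dn$ sets of the form $[n]^{r-1}\times\{x\}\times[n]^{d-r}$ contains exactly one tuple of $T$. *)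

theory Defs
  imports "HOL-Probability.Probability"
begin

definition index_tuples :: "nat \<Rightarrow> nat \<Rightarrow> (nat \<Rightarrow> nat) set" where
  "index_tuples d n = {1..d} \<rightarrow>\<^sub>E {1..n}"

definition planar_assignment :: "nat \<Rightarrow> nat \<Rightarrow> (nat \<Rightarrow> nat) set \<Rightarrow> bool" where
  "planar_assignment d n T \<longleftrightarrow>
     T \<subseteq> index_tuples d n \<and> card T = n \<and> (\<forall>r\<in>{1..d}. (\<lambda>i. i r) ` T = {1..n})"

(* The family of assignments is finite, and nonempty for n \<ge> 1 (it contains the set of
   constant tuples), so Min is a genuine minimum there. *)
definition min_planar_cost :: "nat \<Rightarrow> nat \<Rightarrow> ((nat \<Rightarrow> nat) \<Rightarrow> real) \<Rightarrow> real" where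
  "min_planar_cost d n c = Min ((\<lambda>T. \<Sum>i\<in>T. c i) ` {T. planar_assignment d n T})"

(* The exponential distribution with rate 1 is the one with mean 1. *)
definition exponential_array ::
    "nat \<Rightarrow> nat \<Rightarrow> 'a measure \<Rightarrow> ((nat \<Rightarrow> nat) \<Rightarrow> 'a \<Rightarrow> real) \<Rightarrow> bool" where
  "exponential_array d n M C \<longleftrightarrow>
     prob_space M \<and>
     prob_space.indep_vars M (\<lambda>_. borel) C (index_tuples d n) \<and>
     (\<forall>i\<in>index_tuples d n. distributed M lborel (C i) (exponential_density 1))"

end

theory Submission
  imports Defs "HOL-Real_Asymp.Real_Asymp"
begin

text \<open>
  Lower bound: Chernoff's inequality bounds the probability that a fixed assignment costs at most
  \<open>a / n^(d-2)\<close> by \<open>(e a / n^(d-1))^n\<close>, and there are at most \<open>n^(n(d-1))\<close> assignments.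

  Upper bound: the assignments given by \<open>d - 1\<close> permutations form a spread family, the fraction of
  them containing a given set \<open>S\<close> being at most \<open>q^|S|\<close> with \<open>q = (e/n)^(d-1)\<close>. Hence (Alweiss, Lovett,
  Wu, Zhang; Frankston, Kahn, Narayanan, Park) a random set of density of order \<open>q log n\<close> contains one
  of them with high probability; apply this to the set of entries below a threshold of that order.
  The spread lemma is proved by the minimum fragment argument of Park and Pham: exposing a random set
  of density \<open>16 q\<close> halves the size of what is left to be covered for most members of the family.
  After about \<open>log n\<close> rounds fragments of size \<open>sqrt (log n)\<close> remain, which one further round of
  density \<open>q log n\<close> covers. All densities are written \<open>1 - exp (-s)\<close>, so that the union of
  independent random sets corresponds exactly to the addition of the parameters \<open>s\<close>.
\<close>

section \<open>Spread families and minimum fragments\<close>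

text \<open>For \<open>W\<close> inside \<open>X\<close>, this is the probability that a random
  subset equals \<open>W\<close> when each element of \<open>X\<close> is taken independently with
  probability \<open>1 - exp (- s)\<close>. That is the probability that an exponential cost of mean
  1 is at most \<open>s\<close>.\<close>

definition bern_weight :: "'a set \<Rightarrow> real \<Rightarrow> 'a set \<Rightarrow> real" where
  "bern_weight X s W = (1 - exp (- s)) ^ card W * exp (- s) ^ card (X - W)"

text \<open>The probability that the random subset contains no member of the family. The family is
  indexed, so that coinciding members, as they arise among fragments, keep their
  multiplicity.\<close>

definition miss :: "'a set \<Rightarrow> real \<Rightarrow> 'j set \<Rightarrow> ('j \<Rightarrow> 'a set) \<Rightarrow> real" where
  "miss X s J A = (\<Sum>W\<in>Pow X. bern_weight X s W * of_bool (\<forall>j\<in>J. \<not> A j \<subseteq> W))"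

lemma sum_Pow_insert:
  fixes f :: "'a set \<Rightarrow> real"
  assumes "finite X" "x \<notin> X"
  shows "(\<Sum>W\<in>Pow (insert x X). f W) = (\<Sum>W\<in>Pow X. f W + f (insert x W))"
proof -
  have "inj_on (insert x) (Pow X)"
    using assms(2) by (auto simp: inj_on_def)
  moreover have "Pow X \<inter> insert x ` Pow X = {}"
    using assms(2) by auto
  ultimately show ?thesis
    using assms(1) by (simp add: Pow_insert sum.union_disjoint sum.reindex sum.distrib)
qed

lemma bern_weight_insert:
  assumes "finite X" "x \<notin> X" "W \<subseteq> X"
  shows "bern_weight (insert x X) s W = exp (- s) * bern_weight X s W"
    and "bern_weight (insert x X) s (insert x W) = (1 - exp (- s)) * bern_weight X s W"
proof -
  have "finite W" "x \<notin> W" using assms by (auto intro: finite_subset)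
  moreover have "insert x X - W = insert x (X - W)" "insert x X - insert x W = X - W"
    using assms by auto
  ultimately show "bern_weight (insert x X) s W = exp (- s) * bern_weight X s W"
    "bern_weight (insert x X) s (insert x W) = (1 - exp (- s)) * bern_weight X s W"
    using assms by (simp_all add: bern_weight_def)
qed

lemma bern_weight_nonneg: "s \<ge> 0 \<Longrightarrow> bern_weight X s W \<ge> 0"
  by (simp add: bern_weight_def)

lemma sum_bern_weight: "finite X \<Longrightarrow> (\<Sum>W\<in>Pow X. bern_weight X s W) = 1"
proof (induction X rule: finite_induct)
  case empty
  then show ?case by (simp add: bern_weight_def)
next
  case (insert x X)
  have "(\<Sum>W\<in>Pow (insert x X). bern_weight (insert x X) s W) = (\<Sum>W\<in>Pow X. bern_weight X s W)"
    unfolding sum_Pow_insert[OF insert(1,2)]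
    by (intro sum.cong) (simp_all add: bern_weight_insert[OF insert(1,2)] algebra_simps)
  then show ?case using insert by simp
qed

text \<open>An element avoids both independent sets with probability
  \<open>exp (- s) * exp (- u) = exp (- (s + u))\<close>, so the union has parameter
  \<open>s + u\<close>. An arbitrary test function \<open>g\<close> lets the induction average out
  one element at a time.\<close>

lemma bern_weight_union:
  assumes "finite X"
  shows "(\<Sum>W\<in>Pow X. bern_weight X s W * (\<Sum>V\<in>Pow X. bern_weight X u V * g (W \<union> V)))
    = (\<Sum>W\<in>Pow X. bern_weight X (s + u) W * g W)"
  using assms
proof (induction X arbitrary: g rule: finite_induct)
  case empty
  then show ?case by (simp add: bern_weight_def)
next
  case (insert x X)
  note ins = bern_weight_insert[OF insert(1,2)]
  \<comment> \<open>\<open>h\<close> is \<open>g\<close> averaged over whether \<open>x\<close> lies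
    in the union; it is the test function on the smaller ground set.\<close>
  define h where "h Z = exp (- (s + u)) * g Z + (1 - exp (- (s + u))) * g (insert x Z)" for Z
  have "(\<Sum>W\<in>Pow (insert x X). bern_weight (insert x X) s W *
      (\<Sum>V\<in>Pow (insert x X). bern_weight (insert x X) u V * g (W \<union> V)))
    = (\<Sum>W\<in>Pow X. bern_weight X s W * (\<Sum>V\<in>Pow X. bern_weight X u V * h (W \<union> V)))"
  proof -
    have 1: "(\<Sum>V\<in>Pow X. bern_weight (insert x X) u V * g (W \<union> V)
          + bern_weight (insert x X) u (insert x V) * g (W \<union> insert x V))
        = (\<Sum>V\<in>Pow X. bern_weight X u V * (exp (- u) * g (W \<union> V) + (1 - exp (- u)) * g (insert x (W \<union> V))))"
      for W
      by (intro sum.cong refl) (simp add: ins algebra_simps)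
    have 2: "(\<Sum>V\<in>Pow X. bern_weight (insert x X) u V * g (insert x W \<union> V)
          + bern_weight (insert x X) u (insert x V) * g (insert x W \<union> insert x V))
        = (\<Sum>V\<in>Pow X. bern_weight X u V * g (insert x (W \<union> V)))" for W
      by (intro sum.cong refl) (simp add: ins algebra_simps)
    have 3: "exp (- s) * (\<Sum>V\<in>Pow X. bern_weight X u V * (exp (- u) * g (W \<union> V) + (1 - exp (- u)) * g (insert x (W \<union> V))))
        + (1 - exp (- s)) * (\<Sum>V\<in>Pow X. bern_weight X u V * g (insert x (W \<union> V)))
      = (\<Sum>V\<in>Pow X. bern_weight X u V * h (W \<union> V))" for W
    proof -
      have e: "exp (- (s + u)) = exp (- s) * exp (- u)" by (simp flip: exp_add)
      show ?thesis
        unfolding h_def e sum_distrib_left sum.distrib[symmetric]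
        by (intro sum.cong refl) (simp only: algebra_simps)
    qed
    show ?thesis
      unfolding sum_Pow_insert[OF insert(1,2)] 1 2 3[symmetric]
      by (intro sum.cong refl) (simp add: ins algebra_simps)
  qed
  also have "\<dots> = (\<Sum>W\<in>Pow X. bern_weight X (s + u) W * h W)"
    by (rule insert.IH)
  also have "\<dots> = (\<Sum>W\<in>Pow (insert x X). bern_weight (insert x X) (s + u) W * g W)"
    unfolding sum_Pow_insert[OF insert(1,2)]
    by (intro sum.cong refl) (simp add: ins h_def algebra_simps)
  finally show ?case .
qed

text \<open>Moving one element from outside to inside multiplies the weight by
  \<open>exp s - 1\<close>, which is at least \<open>s\<close>.\<close>

lemma bern_weight_disjoint_union_ge:
  assumes "finite X" "W \<subseteq> X" "S \<subseteq> X" "W \<inter> S = {}" "s > 0"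
  shows "bern_weight X s W \<le> bern_weight X s (W \<union> S) * (1 / s) ^ card S"
proof -
  have fin: "finite W" "finite S" using assms by (auto intro: finite_subset)
  have c1: "card (W \<union> S) = card W + card S"
    using fin assms by (simp add: card_Un_disjoint)
  have "X - W = (X - (W \<union> S)) \<union> S" using assms by auto
  then have "card (X - W) = card ((X - (W \<union> S)) \<union> S)" by simp
  also have "\<dots> = card (X - (W \<union> S)) + card S"
    using assms fin by (intro card_Un_disjoint) auto
  finally have c2: "card (X - W) = card (X - (W \<union> S)) + card S" .
  have "s \<le> exp s - 1" using exp_ge_add_one_self[of s] by linarith
  then have "s * exp (- s) \<le> (exp s - 1) * exp (- s)" by (simp add: mult_right_mono)
  also have "\<dots> = 1 - exp (- s)" by (simp add: algebra_simps mult_exp_exp)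
  finally have "exp (- s) \<le> (1 - exp (- s)) * (1 / s)"
    using assms by (simp add: field_simps)
  then have "exp (- s) ^ card S \<le> ((1 - exp (- s)) * (1 / s)) ^ card S"
    by (intro power_mono) auto
  then have "exp (- s) ^ card S \<le> (1 - exp (- s)) ^ card S * (1 / s) ^ card S"
    by (simp only: power_mult_distrib)
  then have "(1 - exp (- s)) ^ card W * exp (- s) ^ card (X - (W \<union> S)) * exp (- s) ^ card S
    \<le> (1 - exp (- s)) ^ card W * exp (- s) ^ card (X - (W \<union> S))
        * ((1 - exp (- s)) ^ card S * (1 / s) ^ card S)"
    using assms by (intro mult_left_mono) auto
  then show ?thesis
    unfolding bern_weight_def c1 c2 power_add by (simp add: mult_ac)
qed

lemma miss_le_1:
  assumes "finite X" "s \<ge> 0"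
  shows "miss X s J A \<le> 1"
proof -
  have "miss X s J A \<le> (\<Sum>W\<in>Pow X. bern_weight X s W)"
    unfolding miss_def using bern_weight_nonneg[OF assms(2), of X]
    by (intro sum_mono) (auto simp: of_bool_def)
  then show ?thesis using sum_bern_weight[OF assms(1)] by simp
qed

section \<open>Minimum fragments\<close>

text \<open>Once \<open>W\<close> is exposed, covering \<open>A j\<close> may be replaced by
  covering any member inside \<open>A j \<union> W\<close>; the fragment is a smallest remainder
  among these. Ties are broken arbitrarily.\<close>

definition fragment :: "'j set \<Rightarrow> ('j \<Rightarrow> 'a set) \<Rightarrow> 'a set \<Rightarrow> 'j \<Rightarrow> 'a set" where
  "fragment J A W j = (ARG_MIN card F. \<exists>i\<in>J. A i \<subseteq> A j \<union> W \<and> F = A i - W)"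

lemma
  assumes "j \<in> J"
  shows fragment_obtain: "\<exists>i\<in>J. A i \<subseteq> A j \<union> W \<and> fragment J A W j = A i - W"
    and fragment_min: "i \<in> J \<Longrightarrow> A i \<subseteq> A j \<union> W \<Longrightarrow> card (fragment J A W j) \<le> card (A i - W)"
proof -
  let ?P = "\<lambda>F. \<exists>i\<in>J. A i \<subseteq> A j \<union> W \<and> F = A i - W"
  have "?P (A j - W)" using assms by auto
  from arg_min_nat_lemma[of ?P, OF this, of card]
  show "\<exists>i\<in>J. A i \<subseteq> A j \<union> W \<and> fragment J A W j = A i - W"
    and "i \<in> J \<Longrightarrow> A i \<subseteq> A j \<union> W \<Longrightarrow> card (fragment J A W j) \<le> card (A i - W)"
    unfolding fragment_def by auto
qed

lemma fragment_subset: "j \<in> J \<Longrightarrow> fragment J A W j \<subseteq> A j"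
  using fragment_obtain[of j J A W] by auto

lemma fragment_disjoint: "j \<in> J \<Longrightarrow> W \<inter> fragment J A W j = {}"
  using fragment_obtain[of j J A W] by auto

text \<open>The member \<open>i\<close> competes in the minimization for \<open>j\<close>: its
  remainder \<open>A i - W\<close> lies inside the fragment and cannot be smaller, so the two are
  equal.\<close>

lemma fragment_subset_member:
  assumes "j \<in> J" "i \<in> J" "A i \<subseteq> W \<union> fragment J A W j" "finite (A j)"
  shows "fragment J A W j \<subseteq> A i"
proof -
  have sub: "fragment J A W j \<subseteq> A j" by (rule fragment_subset[OF assms(1)])
  then have "card (fragment J A W j) \<le> card (A i - W)"
    using assms by (intro fragment_min) auto
  then have "A i - W = fragment J A W j"
    using assms sub by (intro card_seteq) (auto intro: finite_subset)
  then show ?thesis by auto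
qed

text \<open>With \<open>m = card J\<close> this is the usual notion: a fraction of at most
  \<open>q ^ card S\<close> of the members contains \<open>S\<close>. A separate \<open>m\<close>
  lets the property pass to subfamilies unchanged; \<open>S = {}\<close> gives
  \<open>card J \<le> m\<close>.\<close>

definition spread :: "real \<Rightarrow> real \<Rightarrow> 'j set \<Rightarrow> ('j \<Rightarrow> 'a set) \<Rightarrow> bool" where
  "spread m q J A \<longleftrightarrow> (\<forall>S. finite S \<longrightarrow> real (card {j \<in> J. S \<subseteq> A j}) \<le> m * q ^ card S)"

text \<open>A pair \<open>(W, S)\<close> of a set and a fragment of size \<open>t\<close> is determined by \<open>Z = W \<union> S\<close> and \<open>S\<close>. By minimality \<open>S\<close> lies
  in every member contained in \<open>Z\<close>, in particular in one chosen as a function of \<open>Z\<close> alone; this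
  leaves at most \<open>r choose t\<close> possibilities for \<open>S\<close>.\<close>

lemma fragment_count:
  assumes "finite X" "finite J" and A: "\<And>j. j \<in> J \<Longrightarrow> A j \<subseteq> X" "\<And>j. j \<in> J \<Longrightarrow> card (A j) \<le> r"
    and "spread m q J A" "s > 0" "m > 0" "q > 0"
  shows "(\<Sum>W\<in>Pow X. bern_weight X s W * card {j \<in> J. card (fragment J A W j) = t})
    \<le> m * (r choose t) * (q / s) ^ t"
proof -
  \<comment> \<open>The distinct fragments of size \<open>t\<close>; several \<open>j\<close> may
    share one.\<close>
  define F where "F W = {S. card S = t \<and> (\<exists>j\<in>J. S = fragment J A W j)}" for W
  have finA: "finite (A j)" if "j \<in> J" for j
    using A(1)[OF that] assms(1) finite_subset by auto
  have finF: "finite (F W)" for W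
  proof -
    have "F W \<subseteq> fragment J A W ` J" by (auto simp: F_def)
    then show ?thesis using assms(2) finite_surj by blast
  qed
  have F_sub: "S \<subseteq> X" "W \<inter> S = {}" "card S = t" "finite S" if S: "S \<in> F W" for S W
  proof -
    obtain j where j: "j \<in> J" "S = fragment J A W j" "card S = t" using S by (auto simp: F_def)
    then show "S \<subseteq> X" "W \<inter> S = {}" "card S = t"
      using fragment_subset[of j J A W] fragment_disjoint[of j J W A] A(1) by auto
    show "finite S" using \<open>S \<subseteq> X\<close> assms(1) finite_subset by auto
  qed
  \<comment> \<open>Each \<open>A j\<close> contains its fragment, so by spreadness one fragment is
    shared by at most \<open>m * q ^ t\<close> indices.\<close>
  have cnt: "real (card {j \<in> J. card (fragment J A W j) = t}) \<le> card (F W) * (m * q ^ t)" for W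
  proof -
    have "{j \<in> J. card (fragment J A W j) = t} \<subseteq> (\<Union>S\<in>F W. {j \<in> J. S \<subseteq> A j})"
      using fragment_subset[of _ J A W] by (auto simp: F_def)
    then have "card {j \<in> J. card (fragment J A W j) = t} \<le> card (\<Union>S\<in>F W. {j \<in> J. S \<subseteq> A j})"
      using assms(2) finF by (intro card_mono) auto
    also have "\<dots> \<le> (\<Sum>S\<in>F W. card {j \<in> J. S \<subseteq> A j})"
      by (rule card_UN_le[OF finF])
    finally have "real (card {j \<in> J. card (fragment J A W j) = t})
        \<le> (\<Sum>S\<in>F W. real (card {j \<in> J. S \<subseteq> A j}))" by (simp flip: of_nat_sum)
    also have "\<dots> \<le> (\<Sum>S\<in>F W. m * q ^ t)"
      using assms(5) F_sub unfolding spread_def by (intro sum_mono) metis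
    finally show ?thesis by simp
  qed
  define P where "P = (SIGMA W:Pow X. F W)"
  define B where "B Z = {S. card S = t \<and> S \<subseteq> A (SOME i. i \<in> J \<and> A i \<subseteq> Z)}" for Z
  \<comment> \<open>The union \<open>W \<union> S\<close> contains the member whose remainder is
    \<open>S\<close>. Hence it lies in \<open>D\<close>, where the choice made in \<open>B\<close>
    is meaningful.\<close>
  define D where "D = {Z \<in> Pow X. \<exists>i\<in>J. A i \<subseteq> Z}"
  have chosen: "(SOME i. i \<in> J \<and> A i \<subseteq> Z) \<in> J" "A (SOME i. i \<in> J \<and> A i \<subseteq> Z) \<subseteq> Z" if "Z \<in> D" for Z
    using someI_ex[of "\<lambda>i. i \<in> J \<and> A i \<subseteq> Z"] that by (auto simp: D_def)
  have cardB: "finite (B Z)" "card (B Z) \<le> r choose t" if "Z \<in> D" for Z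
  proof -
    let ?C = "A (SOME i. i \<in> J \<and> A i \<subseteq> Z)"
    have "finite ?C" "card ?C \<le> r" using finA A(2) chosen(1)[OF that] by auto
    moreover have eq: "B Z = {S. S \<subseteq> ?C \<and> card S = t}" by (auto simp: B_def)
    ultimately show "finite (B Z)" "card (B Z) \<le> r choose t"
      by (auto simp: n_subsets eq intro!: binomial_right_mono)
  qed
  have finD: "finite D" using assms(1) by (auto simp: D_def)
  \<comment> \<open>Disjointness of \<open>W\<close> and \<open>S\<close> recovers \<open>W\<close>
    as the difference of \<open>W \<union> S\<close> and \<open>S\<close>.\<close>
  have inj: "inj_on (\<lambda>(W, S). (W \<union> S, S)) P"
    using F_sub(2) by (fastforce simp: inj_on_def P_def)
  have img: "(\<lambda>(W, S). (W \<union> S, S)) ` P \<subseteq> (SIGMA Z:D. B Z)"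
  proof clarsimp
    fix W S assume "(W, S) \<in> P"
    then have W: "W \<subseteq> X" and S: "S \<in> F W" by (auto simp: P_def)
    obtain j where j: "j \<in> J" "S = fragment J A W j" "card S = t" using S by (auto simp: F_def)
    have D: "W \<union> S \<in> D"
      using fragment_obtain[OF j(1), of A W] W F_sub(1)[OF S] j by (auto simp: D_def)
    moreover have "S \<subseteq> A (SOME i. i \<in> J \<and> A i \<subseteq> W \<union> S)"
      using chosen[OF D] j finA by (auto dest!: fragment_subset_member[rotated 2])
    ultimately show "W \<union> S \<in> D \<and> S \<in> B (W \<union> S)"
      using j(3) by (auto simp: B_def)
  qed
  have "(\<Sum>W\<in>Pow X. bern_weight X s W * card (F W)) = (\<Sum>W\<in>Pow X. \<Sum>S\<in>F W. bern_weight X s W)"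
    by (simp add: mult.commute)
  also have "\<dots> = (\<Sum>(W, S)\<in>P. bern_weight X s W)"
    unfolding P_def using assms(1) finF by (intro sum.Sigma) auto
  \<comment> \<open>Trading the weight of \<open>W\<close> for that of \<open>W \<union> S\<close>
    costs \<open>(1 / s) ^ t\<close>; afterwards the sum can run over the unions.\<close>
  also have "\<dots> \<le> (\<Sum>(W, S)\<in>P. bern_weight X s (W \<union> S) * (1 / s) ^ t)"
  proof (intro sum_mono, clarsimp simp del: power_one_over)
    fix W S assume "(W, S) \<in> P"
    then have W: "W \<subseteq> X" and S: "S \<in> F W" by (auto simp: P_def)
    show "bern_weight X s W \<le> bern_weight X s (W \<union> S) * (1 / s) ^ t"
      using bern_weight_disjoint_union_ge[OF assms(1) W F_sub(1,2)[OF S] assms(6)] F_sub(3)[OF S]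
      by simp
  qed
  also have "\<dots> = (\<Sum>(Z, S)\<in>(\<lambda>(W, S). (W \<union> S, S)) ` P. bern_weight X s Z * (1 / s) ^ t)"
    by (subst sum.reindex[OF inj]) (auto intro!: sum.cong)
  also have "\<dots> \<le> (\<Sum>(Z, S)\<in>(SIGMA Z:D. B Z). bern_weight X s Z * (1 / s) ^ t)"
    using finD cardB assms(6) bern_weight_nonneg[of s X]
    by (intro sum_mono2 img) auto
  also have "\<dots> = (\<Sum>Z\<in>D. \<Sum>S\<in>B Z. bern_weight X s Z * (1 / s) ^ t)"
    using finD cardB by (intro sum.Sigma[symmetric]) auto
  also have "\<dots> = (\<Sum>Z\<in>D. card (B Z) * (bern_weight X s Z * (1 / s) ^ t))" by simp
  also have "\<dots> \<le> (\<Sum>Z\<in>D. (r choose t) * (bern_weight X s Z * (1 / s) ^ t))"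
    using cardB assms(6) bern_weight_nonneg[of s X] by (intro sum_mono mult_right_mono) auto
  also have "\<dots> \<le> (\<Sum>Z\<in>Pow X. (r choose t) * (bern_weight X s Z * (1 / s) ^ t))"
    using assms(1,6) bern_weight_nonneg[of s X] by (intro sum_mono2) (auto simp: D_def)
  also have "\<dots> = (r choose t) * ((\<Sum>Z\<in>Pow X. bern_weight X s Z) * (1 / s) ^ t)"
    by (simp only: sum_distrib_left sum_distrib_right)
  also have "\<dots> = (r choose t) * (1 / s) ^ t" by (simp add: sum_bern_weight assms(1))
  finally have main: "(\<Sum>W\<in>Pow X. bern_weight X s W * card (F W)) \<le> (r choose t) * (1 / s) ^ t" .
  have "(\<Sum>W\<in>Pow X. bern_weight X s W * card {j \<in> J. card (fragment J A W j) = t})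
      \<le> (\<Sum>W\<in>Pow X. bern_weight X s W * (card (F W) * (m * q ^ t)))"
    using assms(6) bern_weight_nonneg[of s X] cnt by (intro sum_mono mult_left_mono) auto
  also have "\<dots> = (\<Sum>W\<in>Pow X. bern_weight X s W * card (F W)) * (m * q ^ t)"
    by (simp add: sum_distrib_right mult.assoc)
  also have "\<dots> \<le> ((r choose t) * (1 / s) ^ t) * (m * q ^ t)"
    using assms by (intro mult_right_mono main) auto
  finally show ?thesis by (simp add: power_divide mult_ac)
qed

text \<open>Sums the count over several sizes: the large ones in a halving round, all positive ones
  in the final round.\<close>

lemma fragment_count_set:
  assumes "finite X" "finite J" and "\<And>j. j \<in> J \<Longrightarrow> A j \<subseteq> X" "\<And>j. j \<in> J \<Longrightarrow> card (A j) \<le> r"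
    and "spread m q J A" "s > 0" "m > 0" "q > 0" "finite I"
  shows "(\<Sum>W\<in>Pow X. bern_weight X s W * card {j \<in> J. card (fragment J A W j) \<in> I})
    \<le> m * (\<Sum>t\<in>I. (r choose t) * (q / s) ^ t)"
proof -
  have split: "real (card {j \<in> J. card (fragment J A W j) \<in> I})
      = (\<Sum>t\<in>I. real (card {j \<in> J. card (fragment J A W j) = t}))" for W
  proof -
    have "{j \<in> J. card (fragment J A W j) \<in> I} = (\<Union>t\<in>I. {j \<in> J. card (fragment J A W j) = t})"
      by auto
    then show ?thesis
      using assms(2,9) by (simp add: card_UN_disjoint disjoint_iff)
  qed
  have "(\<Sum>W\<in>Pow X. bern_weight X s W * card {j \<in> J. card (fragment J A W j) \<in> I})
    = (\<Sum>t\<in>I. \<Sum>W\<in>Pow X. bern_weight X s W * card {j \<in> J. card (fragment J A W j) = t})"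
    unfolding split sum_distrib_left by (rule sum.swap)
  also have "\<dots> \<le> (\<Sum>t\<in>I. m * (r choose t) * (q / s) ^ t)"
    using assms by (intro sum_mono fragment_count) auto
  finally show ?thesis by (simp add: sum_distrib_left mult.assoc)
qed

text \<open>Expose \<open>W\<close> first and then an independent \<open>V\<close>. If
  \<open>V\<close> contains a fragment, then \<open>W \<union> V\<close> contains the member whose
  remainder it is. So a miss by the union forces \<open>V\<close> to miss every fragment, in
  particular those of size at most \<open>l\<close>.\<close>

lemma miss_fragment:
  assumes "finite X" "s \<ge> 0" "u \<ge> 0"
  shows "miss X (s + u) J A \<le> (\<Sum>W\<in>Pow X. bern_weight X s W *
    miss X u {j \<in> J. card (fragment J A W j) \<le> l} (fragment J A W))"
proof -
  have "of_bool (\<forall>j\<in>J. \<not> A j \<subseteq> W \<union> V)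
      \<le> (of_bool (\<forall>j\<in>{j \<in> J. card (fragment J A W j) \<le> l}. \<not> fragment J A W j \<subseteq> V) :: real)" for W V
    using fragment_obtain[of _ J A W] by (fastforce simp: of_bool_def)
  then show ?thesis
    unfolding miss_def bern_weight_union[OF assms(1), symmetric]
    using bern_weight_nonneg[OF assms(2), of X] bern_weight_nonneg[OF assms(3), of X]
    by (intro sum_mono mult_left_mono) auto
qed

text \<open>The bound is stated linearly in \<open>card J / m\<close> so that it can be averaged over the random family
  that survives a round, without a Markov inequality in each round.\<close>

lemma miss_final:
  assumes "finite X" "finite J" and "\<And>j. j \<in> J \<Longrightarrow> A j \<subseteq> X" "\<And>j. j \<in> J \<Longrightarrow> card (A j) \<le> r"
    and "spread m q J A" "s > 0" "m > 0" "q > 0"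
  shows "miss X s J A \<le> 2 * (1 - card J / m) + 2 * ((1 + q / s) ^ r - 1)"
proof -
  define e where "e = (1 + q / s) ^ r - 1"
  have e: "e \<ge> 0" using assms by (simp add: e_def)
  have Jm: "real (card J) \<le> m"
    using assms(5) unfolding spread_def by (auto dest!: spec[of _ "{}"])
  have fin: "finite (fragment J A W j)" if "j \<in> J" for W j
    using fragment_subset[OF that, of A W] assms(1) assms(3)[OF that] by (meson finite_subset)
  have sz: "card (fragment J A W j) \<le> r" if "j \<in> J" for W j
    using fragment_subset[OF that, of A W] assms(1) assms(3,4)[OF that]
    by (meson card_mono finite_subset le_trans)
  \<comment> \<open>If \<open>W\<close> contains no member, then no fragment is empty and all of
    \<open>J\<close> is counted on the right.\<close>
  have "card J * of_bool (\<forall>j\<in>J. \<not> A j \<subseteq> W) \<le> real (card {j \<in> J. card (fragment J A W j) \<in> {1..r}})" for W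
  proof (cases "\<forall>j\<in>J. \<not> A j \<subseteq> W")
    case True
    have "card (fragment J A W j) \<in> {1..r}" if j: "j \<in> J" for j
    proof -
      have "fragment J A W j \<noteq> {}" using fragment_obtain[OF j, of A W] True by auto
      then have "card (fragment J A W j) > 0" using fin[OF j] by (simp add: card_gt_0_iff)
      then show ?thesis using sz[OF j] by simp
    qed
    then have "{j \<in> J. card (fragment J A W j) \<in> {1..r}} = J" by auto
    then show ?thesis by simp
  next
    case False
    show ?thesis unfolding of_bool_def if_not_P[OF False] by simp
  qed
  then have "card J * miss X s J A
      \<le> (\<Sum>W\<in>Pow X. bern_weight X s W * card {j \<in> J. card (fragment J A W j) \<in> {1..r}})"
    unfolding miss_def sum_distrib_left using bern_weight_nonneg[of s X] assms(6)
    by (subst mult.left_commute) (intro sum_mono mult_left_mono, auto)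
  also have "\<dots> \<le> m * (\<Sum>t\<in>{1..r}. (r choose t) * (q / s) ^ t)"
    using assms by (intro fragment_count_set) auto
  also have "(\<Sum>t\<in>{1..r}. (r choose t) * (q / s) ^ t) = e"
  proof -
    \<comment> \<open>The binomial theorem; the term \<open>t = 0\<close> is the 1 subtracted in
      \<open>e\<close>.\<close>
    have "(1 + q / s) ^ r = (\<Sum>t\<le>r. (r choose t) * (q / s) ^ t)"
      using binomial_ring[of "q / s" 1 r] by (simp add: add.commute)
    also have "\<dots> = 1 + (\<Sum>t\<in>{1..r}. (r choose t) * (q / s) ^ t)"
      by (simp add: atMost_atLeast0 sum.atLeast_Suc_atMost)
    finally show ?thesis by (simp add: e_def)
  qed
  finally have le: "card J * miss X s J A \<le> m * e" .
  show ?thesis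
  \<comment> \<open>If at most half of \<open>m\<close> is left, the first term of the bound already
    reaches 1. Otherwise dividing by \<open>card J\<close> instead of \<open>m\<close> loses at most
    a factor 2.\<close>
  proof (cases "card J \<le> m / 2")
    case True
    then have "1 \<le> 2 * (1 - card J / m)" using assms by (simp add: field_simps)
    moreover have "miss X s J A \<le> 1" using miss_le_1[OF assms(1), of s J A] assms(6) by simp
    ultimately show ?thesis using e unfolding e_def[symmetric] by linarith
  next
    case False
    have "miss X s J A \<ge> 0"
      unfolding miss_def using assms(6) bern_weight_nonneg[of s X] by (intro sum_nonneg) auto
    then have "m / 2 * miss X s J A \<le> card J * miss X s J A"
      using False by (intro mult_right_mono) auto
    with le have "m * miss X s J A \<le> m * (2 * e)" by simp
    then have "miss X s J A \<le> 2 * e" using assms(7) by simp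
    moreover have "0 \<le> 2 * (1 - card J / m)" using Jm assms(7) by (simp add: field_simps)
    ultimately show ?thesis unfolding e_def[symmetric] by linarith
  qed
qed

section \<open>Iterating the exposure of random sets\<close>

text \<open>A fragment lies inside its member, so passing to fragments and dropping indices only
  lowers the counts; \<open>m\<close> and \<open>q\<close> stay the same.\<close>

lemma spread_fragment:
  fixes A :: "'j \<Rightarrow> 'a set"
  assumes "spread m q J A" "finite J" "J' \<subseteq> J"
  shows "spread m q J' (fragment J A W)"
  unfolding spread_def
proof (intro allI impI)
  fix S :: "'a set" assume S: "finite S"
  have "{j \<in> J'. S \<subseteq> fragment J A W j} \<subseteq> {j \<in> J. S \<subseteq> A j}"
    using fragment_subset[of _ J A W] assms(3) by blast
  then have "card {j \<in> J'. S \<subseteq> fragment J A W j} \<le> card {j \<in> J. S \<subseteq> A j}"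
    using assms(2) by (intro card_mono) auto
  then show "real (card {j \<in> J'. S \<subseteq> fragment J A W j}) \<le> m * q ^ card S"
    using assms(1) S unfolding spread_def by (meson le_trans of_nat_mono order_trans)
qed

text \<open>Induction on the number \<open>k\<close> of halving rounds, each of parameter
  \<open>16 * q\<close>, before a final round of parameter \<open>l * q\<close>. The three terms
  account for indices already missing from \<open>J\<close>, failure of the final round, and indices
  lost in the halving rounds.\<close>

lemma miss_spread:
  assumes "finite X" "finite J" and "\<And>j. j \<in> J \<Longrightarrow> A j \<subseteq> X" "\<And>j. j \<in> J \<Longrightarrow> card (A j) \<le> r * 2 ^ k"
    and "spread m q J A" "m > 0" "q > 0" "l > 0"
  shows "miss X (k * (16 * q) + l * q) J A
    \<le> 2 * (1 - card J / m) + 2 * ((1 + 1 / l) ^ r - 1) + 2 * real k * (1 / 4) ^ r"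
  using assms(2-5)
proof (induction k arbitrary: J A)
  case 0
  \<comment> \<open>Only the final round remains, where \<open>q / s\<close> is
    \<open>1 / l\<close>.\<close>
  then show ?case using miss_final[of X J A r m q "l * q"] assms by simp
next
  case (Suc k)
  note fJ = Suc.prems(1) and AX = Suc.prems(2) and Ac = Suc.prems(3) and sp = Suc.prems(4)
  define n where "n = r * 2 ^ k"
  define c where "c = 2 * ((1 + 1 / l) ^ r - 1) + 2 * real k * (1 / 4) ^ r"
  define J' where "J' W = {j \<in> J. card (fragment J A W j) \<le> n}" for W
  define b where "b W = card {j \<in> J. card (fragment J A W j) \<in> {n<..2 * n}}" for W
  define v where "v = real k * (16 * q) + l * q"
  have v: "v \<ge> 0" using assms by (simp add: v_def)
  have Ac': "card (A j) \<le> 2 * n" if "j \<in> J" for j using Ac[OF that] by (simp add: n_def mult_ac)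
  have q16: "16 * q > 0" using assms by simp
  have sz: "card (fragment J A W j) \<le> 2 * n" if "j \<in> J" for W j
    using fragment_subset[OF that, of A W] assms(1) AX[OF that] Ac'[OF that]
    by (meson card_mono finite_subset le_trans)
  \<comment> \<open>Indices whose fragment is still larger than \<open>n\<close> are dropped. Their
    number \<open>b W\<close> enters the induction hypothesis as an additional deficit
    \<open>2 / m * b W\<close>.\<close>
  have J'c: "real (card (J' W)) = card J - real (b W)" for W
  proof -
    have "J = J' W \<union> {j \<in> J. card (fragment J A W j) \<in> {n<..2 * n}}"
      using sz by (auto simp: J'_def)
    then have "card J = card (J' W \<union> {j \<in> J. card (fragment J A W j) \<in> {n<..2 * n}})" by simp
    also have "\<dots> = card (J' W) + b W"
      unfolding b_def using fJ by (intro card_Un_disjoint) (auto simp: J'_def)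
    finally show ?thesis by simp
  qed
  have IH: "miss X v (J' W) (fragment J A W) \<le> 2 * (1 - card J / m) + c + 2 / m * b W" for W
  proof -
    have "fragment J A W j \<subseteq> X" if "j \<in> J' W" for j
      using that fragment_subset[of j J A W] AX by (auto simp: J'_def)
    then have "miss X v (J' W) (fragment J A W) \<le> 2 * (1 - card (J' W) / m)
        + 2 * ((1 + 1 / l) ^ r - 1) + 2 * real k * (1 / 4) ^ r"
      unfolding v_def using fJ sp
      by (intro Suc.IH) (auto simp: J'_def n_def intro: spread_fragment)
    then show ?thesis unfolding J'c c_def using assms(6) by (simp add: field_simps)
  qed
  \<comment> \<open>This is where 16 comes from: for \<open>t > n\<close> the factor
    \<open>(q / (16 * q)) ^ t\<close> is at most \<open>(1 / 16) ^ n\<close>, and the binomial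
    coefficients add up to at most \<open>4 ^ n\<close>. What remains is \<open>(1 / 4) ^ n\<close>,
    with \<open>n \<ge> r\<close>.\<close>
  have bsum: "(\<Sum>W\<in>Pow X. bern_weight X (16 * q) W * b W) \<le> m * (1 / 4) ^ r"
  proof -
    have "(\<Sum>W\<in>Pow X. bern_weight X (16 * q) W * b W)
        \<le> m * (\<Sum>t\<in>{n<..2 * n}. ((2 * n) choose t) * (q / (16 * q)) ^ t)"
      unfolding b_def using assms fJ AX Ac' sp by (intro fragment_count_set) auto
    also have "(\<Sum>t\<in>{n<..2 * n}. ((2 * n) choose t) * (q / (16 * q)) ^ t)
        \<le> (\<Sum>t\<in>{n<..2 * n}. ((2 * n) choose t) * (1 / 16) ^ n)"
      using assms by (intro sum_mono mult_left_mono) (auto intro!: power_decreasing)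
    also have "\<dots> \<le> (\<Sum>t\<le>2 * n. ((2 * n) choose t) * (1 / 16) ^ n)"
      by (intro sum_mono2) auto
    also have "\<dots> = real (\<Sum>t\<le>2 * n. (2 * n) choose t) * (1 / 16) ^ n"
      by (simp add: sum_distrib_right)
    also have "\<dots> = (1 / 4) ^ n"
      by (simp add: choose_row_sum power_mult flip: power_mult_distrib)
    also have "\<dots> \<le> (1 / 4) ^ r"
      by (intro power_decreasing) (auto simp: n_def)
    finally show ?thesis using assms by simp
  qed
  have "real (Suc k) * (16 * q) + l * q = 16 * q + v" by (simp add: v_def algebra_simps)
  then have "miss X (real (Suc k) * (16 * q) + l * q) J A
      \<le> (\<Sum>W\<in>Pow X. bern_weight X (16 * q) W * miss X v (J' W) (fragment J A W))"
    unfolding J'_def using miss_fragment[of X "16 * q" v J A n] assms(1) v q16 by simp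
  \<comment> \<open>The bound is linear in \<open>b W\<close>, so only the mean of
    \<open>b W\<close> matters.\<close>
  also have "\<dots> \<le> (\<Sum>W\<in>Pow X. bern_weight X (16 * q) W * (2 * (1 - card J / m) + c + 2 / m * b W))"
    using bern_weight_nonneg[of "16 * q" X] q16 IH by (intro sum_mono mult_left_mono) auto
  also have "\<dots> = (\<Sum>W\<in>Pow X. bern_weight X (16 * q) W) * (2 * (1 - card J / m) + c)
      + 2 / m * (\<Sum>W\<in>Pow X. bern_weight X (16 * q) W * b W)"
    unfolding sum_distrib_left sum_distrib_right sum.distrib[symmetric]
    by (intro sum.cong) (simp_all add: algebra_simps)
  also have "\<dots> \<le> 2 * (1 - card J / m) + c + 2 / m * (m * (1 / 4) ^ r)"
    using assms by (intro add_mono mult_left_mono bsum) (auto simp: sum_bern_weight)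
  also have "\<dots> = 2 * (1 - card J / m) + 2 * ((1 + 1 / l) ^ r - 1) + 2 * real (Suc k) * (1 / 4) ^ r"
    using assms by (simp add: c_def algebra_simps)
  finally show ?case .
qed

section \<open>Planar assignments from permutations\<close>

text \<open>Coordinate 1 serves as the label of a tuple, so permutations are chosen only for the
  coordinates from 2 on.\<close>

definition perm_families :: "nat \<Rightarrow> nat \<Rightarrow> (nat \<Rightarrow> nat \<Rightarrow> nat) set" where
  "perm_families d n = {2..d} \<rightarrow>\<^sub>E {p. p permutes {1..n}}"

definition perm_tuple :: "nat \<Rightarrow> (nat \<Rightarrow> nat \<Rightarrow> nat) \<Rightarrow> nat \<Rightarrow> nat \<Rightarrow> nat" where
  "perm_tuple d \<pi> x = (\<lambda>r\<in>{1..d}. if r = 1 then x else \<pi> r x)"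

definition perm_assignment :: "nat \<Rightarrow> nat \<Rightarrow> (nat \<Rightarrow> nat \<Rightarrow> nat) \<Rightarrow> (nat \<Rightarrow> nat) set" where
  "perm_assignment d n \<pi> = perm_tuple d \<pi> ` {1..n}"

section \<open>Spreadness of the family given by permutations\<close>

text \<open>Composing with the inverse of \<open>p0\<close> sends these permutations injectively to
  those fixing \<open>D\<close> pointwise, that is, to permutations of \<open>A - D\<close>.\<close>

lemma card_permutes_extending:
  assumes "finite A" "p0 permutes A" "D \<subseteq> A"
  shows "card {p. p permutes A \<and> (\<forall>x\<in>D. p x = p0 x)} \<le> fact (card A - card D)"
proof -
  have "(\<lambda>p. inv p0 \<circ> p) ` {p. p permutes A \<and> (\<forall>x\<in>D. p x = p0 x)} \<subseteq> {p. p permutes (A - D)}"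
  proof clarsimp
    fix p assume p: "p permutes A" "\<forall>x\<in>D. p x = p0 x"
    have "inv p0 \<circ> p permutes A"
      using p assms by (intro permutes_compose permutes_inv)
    moreover have "(inv p0 \<circ> p) x = x" if "x \<in> D" for x
      using p(2) that permutes_inverses(2)[OF assms(2)] by simp
    ultimately show "inv p0 \<circ> p permutes (A - D)"
      by (auto intro: permutes_superset)
  qed
  moreover have "inj_on (\<lambda>p. inv p0 \<circ> p) {p. p permutes A \<and> (\<forall>x\<in>D. p x = p0 x)}"
  proof (rule inj_onI)
    fix p p' assume "inv p0 \<circ> p = inv p0 \<circ> p'"
    then have "p0 \<circ> (inv p0 \<circ> p) = p0 \<circ> (inv p0 \<circ> p')" by simp
    then show "p = p'"
      using permutes_inv_o(1)[OF assms(2)] by (simp add: o_assoc)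
  qed
  ultimately have "card {p. p permutes A \<and> (\<forall>x\<in>D. p x = p0 x)} \<le> card {p. p permutes (A - D)}"
    using assms(1) by (intro card_inj_on_le) (auto intro: finite_permutations)
  also have "\<dots> = fact (card (A - D))"
    using assms(1) by (intro card_permutations) auto
  also have "card (A - D) = card A - card D"
    using assms by (intro card_Diff_subset) (auto intro: finite_subset)
  finally show ?thesis .
qed

text \<open>The single term \<open>s ^ s / fact s\<close> of the exponential series is at most
  \<open>exp s\<close>.\<close>

lemma power_div_exp_le_fact: "(real s / exp 1) ^ s \<le> fact s"
proof -
  have "real s ^ s /\<^sub>R fact s \<le> exp (real s)"
    unfolding exp_def
    using sum_le_suminf[OF summable_exp_generic, of "{s}" "real s"] by simp
  then have "real s ^ s \<le> exp (real s) * fact s"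
    by (simp add: field_simps)
  moreover have "exp (real s) = exp 1 ^ s" by (simp flip: exp_of_nat_mult)
  ultimately show ?thesis by (simp add: power_divide field_simps)
qed

text \<open>The quotient of \<open>fact n\<close> by \<open>fact (n - s)\<close> is
  \<open>(n choose s) * fact s\<close>, at least
  \<open>(n / s) ^ s * (s / exp 1) ^ s = (n / exp 1) ^ s\<close>.\<close>

lemma fact_diff_le:
  assumes "s \<le> n" "n \<ge> 1"
  shows "fact (n - s) \<le> fact n * (exp 1 / real n) ^ s"
proof (cases "s = 0")
  case False
  have "(real n / exp 1) ^ s = (real n / real s) ^ s * (real s / exp 1) ^ s"
    using False by (simp flip: power_mult_distrib)
  also have "\<dots> \<le> real (n choose s) * fact s"
    using assms by (intro mult_mono binomial_ge_n_over_k_pow_k power_div_exp_le_fact) auto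
  finally have "(real n / exp 1) ^ s * fact (n - s) \<le> real (n choose s) * fact s * fact (n - s)"
    by (intro mult_right_mono) auto
  also have "\<dots> = fact n" using binomial_fact[OF assms(1), where ?'a = real] by simp
  finally show ?thesis using assms by (simp add: power_divide field_simps)
qed simp

lemma perm_families_finite: "finite (perm_families d n)"
  unfolding perm_families_def by (intro finite_PiE) (auto intro: finite_permutations)

lemma card_perm_families: "card (perm_families d n) = fact n ^ (d - 1)"
  unfolding perm_families_def by (simp add: card_PiE card_permutations)

lemma perm_families_nonempty: "perm_families d n \<noteq> {}"
  unfolding perm_families_def PiE_eq_empty_iff by (auto intro: permutes_id)

lemma perm_tuple_first: "d \<ge> 1 \<Longrightarrow> perm_tuple d \<pi> x 1 = x"
  by (simp add: perm_tuple_def)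

lemma inj_on_perm_tuple: "d \<ge> 1 \<Longrightarrow> inj_on (perm_tuple d \<pi>) A"
  by (metis perm_tuple_first inj_onI)

lemma planar_perm_assignment:
  assumes "d \<ge> 1" "\<pi> \<in> perm_families d n"
  shows "planar_assignment d n (perm_assignment d n \<pi>)"
proof -
  have perm: "\<pi> r permutes {1..n}" if "r \<in> {2..d}" for r
    using assms(2) that by (auto simp: perm_families_def)
  have "perm_tuple d \<pi> x \<in> index_tuples d n" if "x \<in> {1..n}" for x
    unfolding index_tuples_def perm_tuple_def
  proof (rule restrict_PiE_iff[THEN iffD2], intro ballI)
    fix r assume "r \<in> {1..d}"
    then show "(if r = 1 then x else \<pi> r x) \<in> {1..n}"
      using perm[of r] that permutes_in_image[of "\<pi> r" "{1..n}" x] by auto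
  qed
  moreover have "card (perm_assignment d n \<pi>) = n"
    unfolding perm_assignment_def using inj_on_perm_tuple[OF assms(1)] by (simp add: card_image)
  moreover have "(\<lambda>i. i r) ` perm_assignment d n \<pi> = {1..n}" if "r \<in> {1..d}" for r
  proof (cases "r = 1")
    case False
    then have "(\<lambda>i. i r) ` perm_assignment d n \<pi> = \<pi> r ` {1..n}"
      using that by (auto simp: perm_assignment_def perm_tuple_def image_image)
    then show ?thesis using perm[of r] False that permutes_image by force
  qed (use assms in \<open>auto simp: perm_assignment_def perm_tuple_def image_image\<close>)
  ultimately show ?thesis
    unfolding planar_assignment_def perm_assignment_def by auto
qed

text \<open>Fix one family \<open>\<rho>\<close> whose assignment contains \<open>S\<close>. Any
  other such family agrees with \<open>\<rho>\<close> on the set \<open>D\<close> of first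
  coordinates of \<open>S\<close>, which leaves at most \<open>fact (n - card S)\<close> choices for
  each of the \<open>d - 1\<close> permutations.\<close>

lemma perm_assignment_spread:
  assumes "d \<ge> 1" "n \<ge> 1"
  shows "spread (fact n ^ (d - 1)) ((exp 1 / real n) ^ (d - 1)) (perm_families d n) (perm_assignment d n)"
  unfolding spread_def
proof (intro allI impI)
  fix S :: "(nat \<Rightarrow> nat) set"
  let ?J = "{\<pi> \<in> perm_families d n. S \<subseteq> perm_assignment d n \<pi>}"
  show "real (card ?J) \<le> fact n ^ (d - 1) * ((exp 1 / real n) ^ (d - 1)) ^ card S"
  proof (cases "?J = {}")
    case False
    then obtain \<rho> where \<rho>: "\<rho> \<in> perm_families d n" "S \<subseteq> perm_assignment d n \<rho>" by blast
    then obtain D where D: "D \<subseteq> {1..n}" "S = perm_tuple d \<rho> ` D"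
      unfolding perm_assignment_def by (meson subset_imageE)
    have cD: "card D = card S"
      using D(2) inj_on_perm_tuple[OF assms(1)] by (simp add: card_image)
    have Dn: "card D \<le> n" using card_mono[OF _ D(1)] by simp
    have "?J \<subseteq> (\<Pi>\<^sub>E r\<in>{2..d}. {p. p permutes {1..n} \<and> (\<forall>x\<in>D. p x = \<rho> r x)})"
    proof
      fix \<pi> assume \<pi>: "\<pi> \<in> ?J"
      have "\<pi> r x = \<rho> r x" if "r \<in> {2..d}" "x \<in> D" for r x
      proof -
        have "perm_tuple d \<rho> x \<in> perm_assignment d n \<pi>" using \<pi> D(2) that by blast
        then obtain y where y: "perm_tuple d \<rho> x = perm_tuple d \<pi> y"
          unfolding perm_assignment_def by blast
        \<comment> \<open>Equal tuples carry the same label, so the tuple of \<open>\<rho>\<close>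
          at \<open>x\<close> must be that of \<open>\<pi>\<close> at \<open>x\<close>.\<close>
        then have "x = y" using perm_tuple_first[OF assms(1)] by metis
        with y have "perm_tuple d \<rho> x r = perm_tuple d \<pi> x r" by simp
        then show ?thesis using that by (auto simp: perm_tuple_def)
      qed
      then show "\<pi> \<in> (\<Pi>\<^sub>E r\<in>{2..d}. {p. p permutes {1..n} \<and> (\<forall>x\<in>D. p x = \<rho> r x)})"
        using \<pi> by (auto simp: perm_families_def PiE_iff)
    qed
    then have "card ?J \<le> card (\<Pi>\<^sub>E r\<in>{2..d}. {p. p permutes {1..n} \<and> (\<forall>x\<in>D. p x = \<rho> r x)})"
      by (intro card_mono finite_PiE) (auto intro: finite_subset[OF _ finite_permutations[of "{1..n}"]])
    also have "\<dots> = (\<Prod>r\<in>{2..d}. card {p. p permutes {1..n} \<and> (\<forall>x\<in>D. p x = \<rho> r x)})"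
      by (simp add: card_PiE)
    also have "\<dots> \<le> (\<Prod>r\<in>{2..d}. fact (card {1..n} - card D))"
      using \<rho>(1) D(1) by (intro prod_mono conjI card_permutes_extending) (auto simp: perm_families_def)
    also have "\<dots> = fact (n - card S) ^ (d - 1)" by (simp add: cD)
    finally have "real (card ?J) \<le> fact (n - card S) ^ (d - 1)"
      by (metis of_nat_fact of_nat_mono of_nat_power)
    also have "\<dots> \<le> (fact n * (exp 1 / real n) ^ card S) ^ (d - 1)"
      using fact_diff_le[of "card S" n] Dn cD assms by (intro power_mono) auto
    also have "\<dots> = fact n ^ (d - 1) * ((exp 1 / real n) ^ (d - 1)) ^ card S"
      by (simp add: power_mult_distrib power_mult[symmetric] mult.commute)
    finally show ?thesis .
  next
    case True
    then show ?thesis by (simp only: card.empty) simp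
  qed
qed

section \<open>The number of planar assignments\<close>

lemma finite_index_tuples: "finite (index_tuples d n)"
  unfolding index_tuples_def by (intro finite_PiE) auto

lemma finite_planar_assignments: "finite {T. planar_assignment d n T}"
  by (rule finite_subset[of _ "Pow (index_tuples d n)"])
    (auto simp: planar_assignment_def finite_index_tuples)

lemma planar_assignments_nonempty:
  assumes "d \<ge> 1"
  shows "{T. planar_assignment d n T} \<noteq> {}"
  using perm_families_nonempty[of d n] planar_perm_assignment[OF assms] by blast

text \<open>An assignment is the image of the map sending \<open>x\<close> to its unique tuple with
  first coordinate \<open>x\<close>; at most \<open>n ^ (d - 1)\<close> tuples are available for
  each \<open>x\<close>.\<close>

lemma card_planar_assignments_le:
  assumes "d \<ge> 1"
  shows "card {T. planar_assignment d n T} \<le> n ^ (n * (d - 1))"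
proof -
  define F where "F = (\<Pi>\<^sub>E x\<in>{1..n}. \<Pi>\<^sub>E r\<in>{1..d}. if r = 1 then {x} else {1..n})"
  have finF: "finite F" unfolding F_def by (intro finite_PiE) auto
  have "{T. planar_assignment d n T} \<subseteq> (\<lambda>f. f ` {1..n}) ` F"
  proof clarify
    fix T assume T: "planar_assignment d n T"
    then have "card T = n" and img: "(\<lambda>i. i 1) ` T = {1..n}" and sub: "T \<subseteq> index_tuples d n"
      using assms by (auto simp: planar_assignment_def)
    \<comment> \<open>There are \<open>n\<close> tuples and \<open>n\<close> first coordinates to be
      taken, so none repeats.\<close>
    then have "inj_on (\<lambda>i. i 1) T"
      by (intro eq_card_imp_inj_on) (auto intro: finite_subset finite_index_tuples)
    then have bij: "bij_betw (\<lambda>i. i 1) T {1..n}" using img by (simp add: bij_betw_def)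
    define g where "g = the_inv_into T (\<lambda>i. i 1)"
    have g: "bij_betw g {1..n} T"
      unfolding g_def using bij by (rule bij_betw_the_inv_into)
    have g1: "g x 1 = x" if "x \<in> {1..n}" for x
      unfolding g_def using f_the_inv_into_f_bij_betw[OF bij] that by simp
    have gT: "g x \<in> {1..d} \<rightarrow>\<^sub>E {1..n}" if "x \<in> {1..n}" for x
      using bij_betw_apply[OF g that] sub by (auto simp only: index_tuples_def)
    have "restrict g {1..n} \<in> F"
      unfolding F_def restrict_PiE_iff using gT g1 by (auto simp: PiE_iff)
    moreover have "T = restrict g {1..n} ` {1..n}"
      using g by (simp add: bij_betw_def)
    ultimately show "T \<in> (\<lambda>f. f ` {1..n}) ` F" by blast
  qed
  then have "card {T. planar_assignment d n T} \<le> card F"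
    using surj_card_le[OF finF] by blast
  also have "card F = (\<Prod>x\<in>{1..n}. \<Prod>r\<in>{1..d}. card (if r = 1 then {x} else {1..n}))"
    unfolding F_def by (simp add: card_PiE)
  also have "\<dots> = (\<Prod>x\<in>{1..n}. n ^ (d - 1))"
  proof (intro prod.cong refl)
    fix x
    have "(\<Prod>r\<in>{1..d}. card (if r = 1 then {x} else {1..n})) = (\<Prod>r\<in>{2..d}. card (if r = 1 then {x} else {1..n}))"
      using assms by (simp add: prod.atLeast_Suc_atMost numeral_2_eq_2)
    also have "\<dots> = n ^ (d - 1)" by simp
    finally show "(\<Prod>r\<in>{1..d}. card (if r = 1 then {x} else {1..n})) = n ^ (d - 1)" .
  qed
  also have "\<dots> = n ^ (n * (d - 1))" by (simp add: power_mult[symmetric] mult.commute)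
  finally show ?thesis .
qed

section \<open>Exponential costs\<close>

text \<open>Each entry is at most \<open>s\<close> with probability \<open>1 - exp (- s)\<close>,
  independently of the others, so the set of cheap entries has the law
  \<open>bern_weight\<close>.\<close>

lemma (in prob_space) prob_below_eq:
  assumes "finite X" "X \<noteq> {}" "indep_vars (\<lambda>_. borel) C X"
    and D: "\<And>x. x \<in> X \<Longrightarrow> distributed M lborel (C x) (exponential_density 1)"
    and "s \<ge> 0" "W \<subseteq> X"
  shows "prob {\<omega> \<in> space M. {x \<in> X. C x \<omega> \<le> s} = W} = bern_weight X s W"
proof -
  define B where "B x = (if x \<in> W then {..s} else {s<..})" for x
  have below: "prob (C x -` B x \<inter> space M) = (if x \<in> W then 1 - exp (- s) else exp (- s))"
    if "x \<in> X" for x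
  proof (cases "x \<in> W")
    case True
    have "C x -` B x \<inter> space M = {\<omega> \<in> space M. C x \<omega> \<le> s}" using True by (auto simp: B_def)
    then show ?thesis using exponential_distributedD_le[OF D[OF that] assms(5)] True by simp
  next
    case False
    have "C x -` B x \<inter> space M = {\<omega> \<in> space M. s < C x \<omega>}" using False by (auto simp: B_def)
    then show ?thesis using exponential_distributedD_gt[OF D[OF that] assms(5)] False by simp
  qed
  have "{\<omega> \<in> space M. {x \<in> X. C x \<omega> \<le> s} = W} = (\<Inter>x\<in>X. C x -` B x \<inter> space M)"
    using assms(2,6) by (auto simp: B_def split: if_splits)
  also have "prob \<dots> = (\<Prod>x\<in>X. prob (C x -` B x \<inter> space M))"
    using assms by (intro indep_varsD_finite) (auto simp: B_def)
  also have "\<dots> = (\<Prod>x\<in>X. if x \<in> W then 1 - exp (- s) else exp (- s))"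
    by (intro prod.cong refl below)
  also have "\<dots> = bern_weight X s W"
  proof -
    have "X \<inter> {x. x \<in> W} = W" "X \<inter> - {x. x \<in> W} = X - W" using assms(6) by auto
    then show ?thesis using assms(1) by (simp add: prod.If_cases bern_weight_def)
  qed
  finally show ?thesis .
qed

lemma (in prob_space) prob_no_member_below:
  assumes "finite X" "X \<noteq> {}" "indep_vars (\<lambda>_. borel) C X"
    and D: "\<And>x. x \<in> X \<Longrightarrow> distributed M lborel (C x) (exponential_density 1)"
    and "s \<ge> 0"
  shows "prob {\<omega> \<in> space M. \<forall>j\<in>J. \<not> A j \<subseteq> {x \<in> X. C x \<omega> \<le> s}} = miss X s J A"
proof -
  define E where "E W = {\<omega> \<in> space M. {x \<in> X. C x \<omega> \<le> s} = W}" for W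
  define B where "B = {W \<in> Pow X. \<forall>j\<in>J. \<not> A j \<subseteq> W}"
  have meas[measurable]: "C x \<in> borel_measurable M" if "x \<in> X" for x
    using assms(3) that by (auto simp: indep_vars_def)
  have E: "E W \<in> events" if "W \<in> B" for W
  proof -
    have "E W = {\<omega> \<in> space M. \<forall>x\<in>X. (C x \<omega> \<le> s) = (x \<in> W)}"
      using that by (auto simp: E_def B_def)
    also have "\<dots> \<in> events" using assms(1) by measurable
    finally show ?thesis .
  qed
  have "{\<omega> \<in> space M. \<forall>j\<in>J. \<not> A j \<subseteq> {x \<in> X. C x \<omega> \<le> s}} = (\<Union>W\<in>B. E W)"
    by (auto simp: E_def B_def)
  also have "prob \<dots> = (\<Sum>W\<in>B. prob (E W))"
    using assms(1) E by (intro finite_measure_finite_Union) (auto simp: B_def E_def disjoint_family_on_def)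
  also have "\<dots> = (\<Sum>W\<in>B. bern_weight X s W)"
    unfolding E_def using assms by (intro sum.cong refl prob_below_eq) (auto simp: B_def)
  also have "\<dots> = miss X s J A"
    unfolding miss_def B_def using assms(1)
    by (subst sum.inter_filter) (auto intro!: sum.cong simp: of_bool_def)
  finally show ?thesis .
qed

section \<open>Laplace transform and Chernoff bound\<close>

lemma (in prob_space) exponential_laplace:
  assumes D: "distributed M lborel Y (exponential_density 1)" and "\<theta> \<ge> 0"
  shows "(\<integral>\<^sup>+\<omega>. ennreal (exp (- \<theta> * Y \<omega>)) \<partial>M) = ennreal (1 / (1 + \<theta>))"
proof -
  have "(\<integral>\<^sup>+\<omega>. ennreal (exp (- \<theta> * Y \<omega>)) \<partial>M)
      = (\<integral>\<^sup>+x. ennreal (exponential_density 1 x) * ennreal (exp (- \<theta> * x)) \<partial>lborel)"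
    by (rule distributed_nn_integral[OF D, symmetric]) measurable
  \<comment> \<open>Tilting by \<open>exp (- \<theta> * x)\<close> turns the density of rate 1 into
    that of rate \<open>1 + \<theta>\<close>, up to the factor
    \<open>1 / (1 + \<theta>)\<close>.\<close>
  also have "\<dots> = (\<integral>\<^sup>+x. ennreal (1 / (1 + \<theta>)) * ennreal (exponential_density (1 + \<theta>) x) \<partial>lborel)"
    using assms(2)
    by (intro nn_integral_cong)
      (auto simp: exponential_density_def mult_exp_exp simp flip: ennreal_mult, simp add: algebra_simps)
  also have "\<dots> = ennreal (1 / (1 + \<theta>)) * (\<integral>\<^sup>+x. ennreal (exponential_density (1 + \<theta>) x) \<partial>lborel)"
    by (rule nn_integral_cmult) measurable
  also have "(\<integral>\<^sup>+x. ennreal (exponential_density (1 + \<theta>) x) \<partial>lborel) = 1"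
    using prob_space.emeasure_space_1[OF prob_space_exponential_density[of "1 + \<theta>"]] assms(2)
    by (simp add: emeasure_density)
  finally show ?thesis by simp
qed

text \<open>Markov's inequality for the exponential of \<open>\<theta>\<close> times
  \<open>u\<close> minus the sum, whose expectation factors by independence. Nonnegative integrals
  avoid any question of integrability.\<close>

lemma (in prob_space) exponential_sum_tail:
  assumes "finite T" "indep_vars (\<lambda>_. borel) C T"
    and D: "\<And>x. x \<in> T \<Longrightarrow> distributed M lborel (C x) (exponential_density 1)" and "\<theta> \<ge> 0"
  shows "prob {\<omega> \<in> space M. (\<Sum>x\<in>T. C x \<omega>) \<le> u} \<le> exp (\<theta> * u) * (1 / (1 + \<theta>)) ^ card T"
proof -
  have meas[measurable]: "C x \<in> borel_measurable M" if "x \<in> T" for x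
    using assms(2) that by (auto simp: indep_vars_def)
  have eq: "(\<Prod>x\<in>T. ennreal (exp (- \<theta> * C x \<omega>))) = ennreal (exp (- \<theta> * (\<Sum>x\<in>T. C x \<omega>)))" for \<omega>
    using assms(1) by (simp add: prod_ennreal exp_sum[symmetric] sum_negf sum_distrib_left)
  have "{\<omega> \<in> space M. (\<Sum>x\<in>T. C x \<omega>) \<le> u}
      \<subseteq> {\<omega> \<in> space M. 1 \<le> ennreal (exp (\<theta> * u)) * (\<Prod>x\<in>T. ennreal (exp (- \<theta> * C x \<omega>)))}"
  proof clarify
    fix \<omega> assume "(\<Sum>x\<in>T. C x \<omega>) \<le> u"
    then have "\<theta> * (\<Sum>x\<in>T. C x \<omega>) \<le> \<theta> * u" using assms(4) by (intro mult_left_mono)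
    then have "1 \<le> exp (\<theta> * u) * exp (- \<theta> * (\<Sum>x\<in>T. C x \<omega>))" by (simp add: mult_exp_exp)
    then show "1 \<le> ennreal (exp (\<theta> * u)) * (\<Prod>x\<in>T. ennreal (exp (- \<theta> * C x \<omega>)))"
      unfolding eq by (simp flip: ennreal_mult)
  qed
  then have "emeasure M {\<omega> \<in> space M. (\<Sum>x\<in>T. C x \<omega>) \<le> u}
      \<le> emeasure M {\<omega> \<in> space M. 1 \<le> ennreal (exp (\<theta> * u)) * (\<Prod>x\<in>T. ennreal (exp (- \<theta> * C x \<omega>)))}"
    by (intro emeasure_mono) measurable
  also have "\<dots> \<le> ennreal (exp (\<theta> * u)) * (\<integral>\<^sup>+\<omega>. (\<Prod>x\<in>T. ennreal (exp (- \<theta> * C x \<omega>))) \<partial>M)"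
  proof -
    have "(\<integral>\<^sup>+\<omega>. (\<Prod>x\<in>T. ennreal (exp (- \<theta> * C x \<omega>))) * indicator (space M) \<omega> \<partial>M)
        = (\<integral>\<^sup>+\<omega>. (\<Prod>x\<in>T. ennreal (exp (- \<theta> * C x \<omega>))) \<partial>M)"
      by (intro nn_integral_cong) auto
    moreover have "(\<lambda>\<omega>. (\<Prod>x\<in>T. ennreal (exp (- \<theta> * C x \<omega>))) * indicator (space M) \<omega>) \<in> borel_measurable M"
      by measurable
    ultimately show ?thesis
      using nn_integral_Markov_inequality[of "\<lambda>\<omega>. \<Prod>x\<in>T. ennreal (exp (- \<theta> * C x \<omega>))" "space M" M "ennreal (exp (\<theta> * u))"]
      by simp
  qed
  also have "(\<integral>\<^sup>+\<omega>. (\<Prod>x\<in>T. ennreal (exp (- \<theta> * C x \<omega>))) \<partial>M)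
      = (\<Prod>x\<in>T. \<integral>\<^sup>+\<omega>. ennreal (exp (- \<theta> * C x \<omega>)) \<partial>M)"
  proof (rule indep_vars_nn_integral[OF assms(1)])
    show "indep_vars (\<lambda>_. borel) (\<lambda>x \<omega>. ennreal (exp (- \<theta> * C x \<omega>))) T"
      by (rule indep_vars_compose2[OF assms(2), where Y = "\<lambda>_ y. ennreal (exp (- \<theta> * y))"]) measurable
  qed simp
  also have "\<dots> = (\<Prod>x\<in>T. ennreal (1 / (1 + \<theta>)))"
    by (intro prod.cong refl exponential_laplace D assms(4))
  also have "\<dots> = ennreal ((1 / (1 + \<theta>)) ^ card T)"
    using assms(4) by (simp add: ennreal_power)
  finally have "emeasure M {\<omega> \<in> space M. (\<Sum>x\<in>T. C x \<omega>) \<le> u}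
      \<le> ennreal (exp (\<theta> * u) * (1 / (1 + \<theta>)) ^ card T)"
    using assms(4) by (simp add: ennreal_mult)
  then show ?thesis using assms(4) by (simp add: emeasure_eq_measure)
qed

section \<open>Tails of the minimum cost\<close>

lemma exponential_arrayD:
  assumes "exponential_array d n M C"
  shows "prob_space M" "prob_space.indep_vars M (\<lambda>_. borel) C (index_tuples d n)"
    "i \<in> index_tuples d n \<Longrightarrow> distributed M lborel (C i) (exponential_density 1)"
    "i \<in> index_tuples d n \<Longrightarrow> C i \<in> borel_measurable M"
  using assms distributed_measurable[of M lborel "C i"] unfolding exponential_array_def by auto

lemma min_planar_cost_measurable:
  assumes "exponential_array d n M C"
  shows "(\<lambda>\<omega>. min_planar_cost d n (\<lambda>i. C i \<omega>)) \<in> borel_measurable M"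
  unfolding min_planar_cost_def
  using exponential_arrayD(4)[OF assms]
  by (intro borel_measurable_Min borel_measurable_sum finite_planar_assignments)
    (auto simp: planar_assignment_def)

lemma min_planar_cost_le:
  "planar_assignment d n T \<Longrightarrow> min_planar_cost d n c \<le> (\<Sum>i\<in>T. c i)"
  unfolding min_planar_cost_def using finite_planar_assignments by (intro Min_le) auto

lemma min_planar_cost_attained:
  assumes "d \<ge> 1"
  obtains T where "planar_assignment d n T" "min_planar_cost d n c = (\<Sum>i\<in>T. c i)"
proof -
  have "min_planar_cost d n c \<in> (\<lambda>T. \<Sum>i\<in>T. c i) ` {T. planar_assignment d n T}"
    unfolding min_planar_cost_def
    using finite_planar_assignments planar_assignments_nonempty[OF assms] by (intro Min_in) auto
  then show ?thesis using that by auto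
qed

lemma min_planar_cost_lower_tail:
  assumes "exponential_array d n M C" "d \<ge> 2" "n \<ge> 1" "a > 0"
  shows "measure M {\<omega> \<in> space M. min_planar_cost d n (\<lambda>i. C i \<omega>) \<le> a / real n ^ (d - 2)} \<le> (exp 1 * a) ^ n"
proof -
  interpret prob_space M by (rule exponential_arrayD(1)[OF assms(1)])
  define P where "P = {T. planar_assignment d n T}"
  define u where "u = a / real n ^ (d - 2)"
  \<comment> \<open>With this choice \<open>\<theta> * u = n\<close>, and
    \<open>(1 / \<theta>) ^ n\<close> cancels the number \<open>n ^ (n * (d - 1))\<close> of
    assignments, leaving \<open>(exp 1 * a) ^ n\<close>.\<close>
  define \<theta> where "\<theta> = real n ^ (d - 1) / a"
  have \<theta>: "\<theta> > 0" using assms by (simp add: \<theta>_def)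
  have "d - 1 = Suc (d - 2)" using assms by simp
  then have \<theta>u: "\<theta> * u = real n" using assms by (simp add: \<theta>_def u_def)
  have T: "T \<subseteq> index_tuples d n" "card T = n" "finite T" if "T \<in> P" for T
    using that finite_subset[OF _ finite_index_tuples, of T d n] by (auto simp: P_def planar_assignment_def)
  have finP: "finite P" unfolding P_def by (rule finite_planar_assignments)
  have ev: "{\<omega> \<in> space M. (\<Sum>i\<in>T. C i \<omega>) \<le> u} \<in> events" if "T \<in> P" for T
  proof -
    have "(\<lambda>\<omega>. \<Sum>i\<in>T. C i \<omega>) \<in> borel_measurable M"
      using T[OF that] exponential_arrayD(4)[OF assms(1)] by (intro borel_measurable_sum) auto
    then show ?thesis by measurable
  qed
  have "prob {\<omega> \<in> space M. min_planar_cost d n (\<lambda>i. C i \<omega>) \<le> u}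
      \<le> prob (\<Union>T\<in>P. {\<omega> \<in> space M. (\<Sum>i\<in>T. C i \<omega>) \<le> u})"
  proof (intro finite_measure_mono sets.finite_UN finP ev subsetI)
    fix \<omega> assume \<omega>: "\<omega> \<in> {\<omega> \<in> space M. min_planar_cost d n (\<lambda>i. C i \<omega>) \<le> u}"
    obtain T where "planar_assignment d n T" "min_planar_cost d n (\<lambda>i. C i \<omega>) = (\<Sum>i\<in>T. C i \<omega>)"
      using assms(2) by (auto intro: min_planar_cost_attained[of d n "\<lambda>i. C i \<omega>"])
    then show "\<omega> \<in> (\<Union>T\<in>P. {\<omega> \<in> space M. (\<Sum>i\<in>T. C i \<omega>) \<le> u})"
      using \<omega> by (auto simp: P_def)
  qed
  also have "\<dots> \<le> (\<Sum>T\<in>P. prob {\<omega> \<in> space M. (\<Sum>i\<in>T. C i \<omega>) \<le> u})"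
    using finP ev by (intro finite_measure_subadditive_finite) auto
  also have "\<dots> \<le> (\<Sum>T\<in>P. exp (\<theta> * u) * (1 / (1 + \<theta>)) ^ n)"
  proof (intro sum_mono)
    fix T assume TP: "T \<in> P"
    show "prob {\<omega> \<in> space M. (\<Sum>i\<in>T. C i \<omega>) \<le> u} \<le> exp (\<theta> * u) * (1 / (1 + \<theta>)) ^ n"
      unfolding T(2)[OF TP, symmetric]
      using exponential_sum_tail[of T C \<theta> u] T(1,3)[OF TP] \<theta> exponential_arrayD(3)[OF assms(1)]
        indep_vars_subset[OF exponential_arrayD(2)[OF assms(1)] T(1)[OF TP]] by auto
  qed
  also have "\<dots> = card P * (exp (real n) * (1 / (1 + \<theta>)) ^ n)" by (simp add: \<theta>u)
  also have "\<dots> \<le> real (n ^ (n * (d - 1))) * (exp (real n) * (1 / \<theta>) ^ n)"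
    using card_planar_assignments_le[of d n] assms \<theta> unfolding P_def
    by (intro mult_mono of_nat_mono power_mono) (auto simp: frac_le)
  also have "\<dots> = (real n ^ (d - 1) * (exp 1 * (1 / \<theta>))) ^ n"
  proof -
    have "exp (real n) = exp 1 ^ n" by (simp flip: exp_of_nat_mult)
    then show ?thesis
      by (simp only: power_mult_distrib of_nat_power mult.commute[of n] power_mult)
  qed
  also have "real n ^ (d - 1) * (exp 1 * (1 / \<theta>)) = exp 1 * a"
    using assms by (simp add: \<theta>_def)
  finally show ?thesis by (simp add: u_def)
qed

text \<open>An assignment made of entries of cost at most \<open>s\<close> costs at most
  \<open>n * s\<close>, hence at most \<open>b\<close>. So the minimum exceeds \<open>b\<close> only
  if the set of cheap entries contains no member of the spread family.\<close>

lemma min_planar_cost_upper_tail: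
  assumes "exponential_array d n M C" "d \<ge> 1" "n \<ge> 1" "l > 0" "n \<le> r * 2 ^ k"
    and b: "real n * ((real k * 16 + l) * (exp 1 / real n) ^ (d - 1)) \<le> b"
  shows "measure M {\<omega> \<in> space M. \<not> min_planar_cost d n (\<lambda>i. C i \<omega>) \<le> b}
    \<le> 2 * ((1 + 1 / l) ^ r - 1) + 2 * real k * (1 / 4) ^ r"
proof -
  interpret prob_space M by (rule exponential_arrayD(1)[OF assms(1)])
  define X where "X = index_tuples d n"
  define q where "q = (exp 1 / real n) ^ (d - 1)"
  define s where "s = real k * (16 * q) + l * q"
  have q: "q > 0" using assms by (simp add: q_def)
  have s: "s \<ge> 0" using q assms by (simp add: s_def)
  have "finite X" by (simp add: X_def finite_index_tuples)
  moreover have "X \<noteq> {}" using assms(3) by (auto simp: X_def index_tuples_def PiE_eq_empty_iff)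
  ultimately have X: "finite X" "X \<noteq> {}" by auto
  have Cm[measurable]: "x \<in> X \<Longrightarrow> C x \<in> borel_measurable M" for x
    using exponential_arrayD(4)[OF assms(1)] by (simp add: X_def)
  have pa: "perm_assignment d n \<pi> \<subseteq> X" "card (perm_assignment d n \<pi>) = n"
    if "\<pi> \<in> perm_families d n" for \<pi>
    using planar_perm_assignment[OF assms(2) that] by (auto simp: planar_assignment_def X_def)
  have nb: "real n * s \<le> b" using b by (simp add: s_def q_def algebra_simps)
  have "prob {\<omega> \<in> space M. \<not> min_planar_cost d n (\<lambda>i. C i \<omega>) \<le> b}
      \<le> prob {\<omega> \<in> space M. \<forall>\<pi>\<in>perm_families d n. \<not> perm_assignment d n \<pi> \<subseteq> {x \<in> X. C x \<omega> \<le> s}}"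
  proof (intro finite_measure_mono subsetI)
    fix \<omega> assume \<omega>: "\<omega> \<in> {\<omega> \<in> space M. \<not> min_planar_cost d n (\<lambda>i. C i \<omega>) \<le> b}"
    have "\<not> perm_assignment d n \<pi> \<subseteq> {x \<in> X. C x \<omega> \<le> s}" if "\<pi> \<in> perm_families d n" for \<pi>
    proof
      assume sub: "perm_assignment d n \<pi> \<subseteq> {x \<in> X. C x \<omega> \<le> s}"
      have "min_planar_cost d n (\<lambda>i. C i \<omega>) \<le> (\<Sum>i\<in>perm_assignment d n \<pi>. C i \<omega>)"
        by (intro min_planar_cost_le planar_perm_assignment assms that)
      also have "\<dots> \<le> (\<Sum>i\<in>perm_assignment d n \<pi>. s)"
        using sub by (intro sum_mono) auto
      also have "\<dots> \<le> b" using nb pa(2)[OF that] by simp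
      finally show False using \<omega> by simp
    qed
    then show "\<omega> \<in> {\<omega> \<in> space M. \<forall>\<pi>\<in>perm_families d n. \<not> perm_assignment d n \<pi> \<subseteq> {x \<in> X. C x \<omega> \<le> s}}"
      using \<omega> by simp
  next
    \<comment> \<open>Measurability is read off from quantifiers over finite sets.\<close>
    have "{\<omega> \<in> space M. \<forall>\<pi>\<in>perm_families d n. \<not> perm_assignment d n \<pi> \<subseteq> {x \<in> X. C x \<omega> \<le> s}}
      = {\<omega> \<in> space M. \<forall>\<pi>\<in>perm_families d n. \<exists>x\<in>X. x \<in> perm_assignment d n \<pi> \<and> \<not> C x \<omega> \<le> s}"
      using pa(1) by fastforce
    also have "\<dots> \<in> events" using X(1) perm_families_finite[of d n] by measurable
    finally show "{\<omega> \<in> space M. \<forall>\<pi>\<in>perm_families d n. \<not> perm_assignment d n \<pi> \<subseteq> {x \<in> X. C x \<omega> \<le> s}} \<in> events" .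
  qed
  also have "\<dots> = miss X s (perm_families d n) (perm_assignment d n)"
    using X s exponential_arrayD[OF assms(1)] by (intro prob_no_member_below) (auto simp: X_def)
  also have "\<dots> \<le> 2 * (1 - card (perm_families d n) / fact n ^ (d - 1))
      + 2 * ((1 + 1 / l) ^ r - 1) + 2 * real k * (1 / 4) ^ r"
    unfolding s_def
    using X(1) pa assms q perm_assignment_spread[OF assms(2,3)]
    by (intro miss_spread) (auto simp: perm_families_finite q_def)
  \<comment> \<open>Initially no index is missing: the whole family has exactly
    \<open>fact n ^ (d - 1)\<close> indices.\<close>
  also have "\<dots> = 2 * ((1 + 1 / l) ^ r - 1) + 2 * real k * (1 / 4) ^ r"
    by (simp add: card_perm_families)
  finally show ?thesis .
qed

section \<open>Choice of parameters and the limit\<close>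

text \<open>Halving \<open>k\<close> times brings the size from \<open>n\<close> down to
  \<open>r\<close>. The size \<open>r\<close> near \<open>sqrt (ln n)\<close> is small against
  \<open>ln n\<close>, for the final round, yet large enough that \<open>(1 / 4) ^ r\<close> beats
  the number of rounds.\<close>

lemma stage_parameters:
  fixes n :: nat
  assumes "n \<ge> 3"
  defines "r \<equiv> nat \<lceil>sqrt (ln n)\<rceil>" and "k \<equiv> nat \<lceil>log 2 n\<rceil>"
  shows "n \<le> r * 2 ^ k" "real k \<le> 3 * ln n"
    "2 * ((1 + 1 / ln n) ^ r - 1) + 2 * real k * (1 / 4) ^ r
      \<le> 2 * (exp ((sqrt (ln n) + 1) / ln n) - 1) + 6 * ln n * (1 / 4) powr sqrt (ln n)"
proof -
  have "exp 1 \<le> real n" using exp_le assms(1) by linarith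
  then have ln1: "ln (real n) \<ge> 1" using assms(1) by (simp add: ln_ge_iff)
  have sq: "sqrt (ln n) \<ge> 1" using ln1 by simp
  have r: "sqrt (ln n) \<le> real r" "real r \<le> sqrt (ln n) + 1"
    using sq unfolding r_def by linarith+
  have log: "log 2 (real n) \<ge> 0" using assms(1) by simp
  have k: "log 2 n \<le> real k" "real k \<le> log 2 n + 1"
    using log unfolding k_def by linarith+
  have "real n = 2 powr log 2 n" using assms(1) by simp
  also have "\<dots> \<le> 2 powr real k" using k(1) by (intro powr_mono) auto
  also have "\<dots> = 2 ^ k" by (simp add: powr_realpow)
  finally have "n \<le> 2 ^ k" by (simp flip: of_nat_le_iff)
  moreover have "r \<ge> 1" using r(1) sq by linarith
  ultimately show "n \<le> r * 2 ^ k" by (metis mult_le_mono nat_mult_1)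
  \<comment> \<open>This gives \<open>log 2 n \<le> 2 * ln n\<close>; rounding up adds at most 1,
    which is at most \<open>ln n\<close> as \<open>n \<ge> 3\<close>.\<close>
  have "1 / 2 \<le> ln (2 :: real)" using ln2_ge_two_thirds by linarith
  then have "ln n / ln 2 \<le> ln n / (1 / 2)" using ln1 by (intro divide_left_mono) auto
  then have "log 2 n \<le> 2 * ln n" by (simp add: log_def)
  then show k3: "real k \<le> 3 * ln n" using k(2) ln1 by linarith
  have "(1 + 1 / ln n) ^ r \<le> exp (1 / ln n) ^ r"
    using ln1 exp_ge_add_one_self[of "1 / ln n"] by (intro power_mono) auto
  also have "\<dots> = exp (real r / ln n)" by (simp flip: exp_of_nat_mult)
  also have "\<dots> \<le> exp ((sqrt (ln n) + 1) / ln n)"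
    using r(2) ln1 by (simp add: divide_right_mono)
  finally have 1: "(1 + 1 / ln n) ^ r \<le> exp ((sqrt (ln n) + 1) / ln n)" .
  have "(1 / 4) ^ r = (1 / 4 :: real) powr real r" by (simp add: powr_realpow)
  also have "\<dots> \<le> (1 / 4) powr sqrt (ln n)" using r(1) by (intro powr_mono') auto
  finally have "2 * real k * (1 / 4) ^ r \<le> 2 * (3 * ln n) * (1 / 4) powr sqrt (ln n)"
    using k3 by (intro mult_mono) auto
  with 1 show "2 * ((1 + 1 / ln n) ^ r - 1) + 2 * real k * (1 / 4) ^ r
      \<le> 2 * (exp ((sqrt (ln n) + 1) / ln n) - 1) + 6 * ln n * (1 / 4) powr sqrt (ln n)"
    by simp
qed

lemma min_planar_cost_concentration:
  assumes "exponential_array d n M C" "d \<ge> 2" "n \<ge> 3"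
  shows "measure M {\<omega> \<in> space M. exp (- 2) / real n ^ (d - 2) \<le> min_planar_cost d n (\<lambda>i. C i \<omega>) \<and>
      min_planar_cost d n (\<lambda>i. C i \<omega>) \<le> 49 * exp 1 ^ (d - 1) * ln (real n) / real n ^ (d - 2)}
    \<ge> 1 - (exp (- 1) ^ n + (2 * (exp ((sqrt (ln n) + 1) / ln n) - 1) + 6 * ln n * (1 / 4) powr sqrt (ln n)))"
    (is "measure M {\<omega> \<in> space M. ?a \<le> ?Z \<omega> \<and> ?Z \<omega> \<le> ?b} \<ge> 1 - (_ + ?err)")
proof -
  interpret prob_space M by (rule exponential_arrayD(1)[OF assms(1)])
  have Z[measurable]: "?Z \<in> borel_measurable M" by (rule min_planar_cost_measurable[OF assms(1)])
  define r where "r = nat \<lceil>sqrt (ln n)\<rceil>"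
  define k where "k = nat \<lceil>log 2 n\<rceil>"
  note params = stage_parameters[OF assms(3), folded r_def k_def]
  have lnpos: "ln (real n) > 0" using assms(3) by simp
  have "d - 1 = Suc (d - 2)" using assms(2) by simp
  then have npow: "real n * (1 / real n) ^ (d - 1) = 1 / real n ^ (d - 2)"
    using assms(3) by (simp add: power_divide)
  have "real n * ((real k * 16 + ln n) * (exp 1 / real n) ^ (d - 1))
      = (real k * 16 + ln n) * (exp 1 ^ (d - 1) * (real n * (1 / real n) ^ (d - 1)))"
    by (simp add: power_divide)
  \<comment> \<open>Here \<open>49 = 3 * 16 + 1\<close>: at most \<open>3 * ln n\<close> rounds of
    parameter \<open>16 * q\<close> and a last one of parameter \<open>ln n * q\<close>.\<close>
  also have "\<dots> \<le> (49 * ln n) * (exp 1 ^ (d - 1) * (real n * (1 / real n) ^ (d - 1)))"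
    using params(2) by (intro mult_right_mono) auto
  also have "\<dots> = ?b" unfolding npow by simp
  finally have upper: "prob {\<omega> \<in> space M. \<not> ?Z \<omega> \<le> ?b} \<le> ?err"
    using min_planar_cost_upper_tail[OF assms(1), of "ln n" r k ?b] assms params(1,3) lnpos by simp
  \<comment> \<open>Any constant below \<open>exp (- 1)\<close> in place of \<open>exp (- 2)\<close>
    would make the lower tail decay geometrically.\<close>
  have "exp 1 * exp (- 2) = (exp (- 1) :: real)" by (simp add: mult_exp_exp)
  then have lower: "prob {\<omega> \<in> space M. ?Z \<omega> \<le> ?a} \<le> exp (- 1) ^ n"
    using min_planar_cost_lower_tail[OF assms(1,2), of "exp (- 2)"] assms(3) by simp
  have "1 - prob {\<omega> \<in> space M. ?a \<le> ?Z \<omega> \<and> ?Z \<omega> \<le> ?b}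
      = prob (space M - {\<omega> \<in> space M. ?a \<le> ?Z \<omega> \<and> ?Z \<omega> \<le> ?b})"
    by (rule prob_compl[symmetric]) measurable
  also have "\<dots> \<le> prob ({\<omega> \<in> space M. ?Z \<omega> \<le> ?a} \<union> {\<omega> \<in> space M. \<not> ?Z \<omega> \<le> ?b})"
    by (intro finite_measure_mono) (auto intro!: sets.Un)
  also have "\<dots> \<le> prob {\<omega> \<in> space M. ?Z \<omega> \<le> ?a} + prob {\<omega> \<in> space M. \<not> ?Z \<omega> \<le> ?b}"
    by (intro measure_Un_le) measurable
  finally show ?thesis using upper lower by linarith
qed

theorem theorem1:
  fixes d :: nat
  assumes "d \<ge> 3"
  shows "\<exists>a>0. \<exists>b>0. \<forall>(M :: nat \<Rightarrow> 'a measure) (C :: nat \<Rightarrow> (nat \<Rightarrow> nat) \<Rightarrow> 'a \<Rightarrow> real).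
    (\<forall>n\<ge>1. exponential_array d n (M n) (C n)) \<longrightarrow>
    (\<lambda>n. measure (M n) {\<omega> \<in> space (M n).
            a / real n ^ (d - 2) \<le> min_planar_cost d n (\<lambda>i. C n i \<omega>) \<and>
            min_planar_cost d n (\<lambda>i. C n i \<omega>) \<le> b * ln (real n) / real n ^ (d - 2)})
      \<longlonglongrightarrow> 1"
\<comment> \<open>Both witnesses are fixed before \<open>M\<close> and \<open>C\<close>; the first
  is absolute and the second depends on \<open>d\<close> alone.\<close>
proof (rule exI[of _ "exp (- 2)"], rule conjI[OF exp_gt_zero],
    rule exI[of _ "49 * exp 1 ^ (d - 1)"], intro conjI allI impI)
  fix M :: "nat \<Rightarrow> 'a measure" and C :: "nat \<Rightarrow> (nat \<Rightarrow> nat) \<Rightarrow> 'a \<Rightarrow> real"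
  assume arr: "\<forall>n\<ge>1. exponential_array d n (M n) (C n)"
  let ?P = "\<lambda>n. measure (M n) {\<omega> \<in> space (M n).
            exp (- 2) / real n ^ (d - 2) \<le> min_planar_cost d n (\<lambda>i. C n i \<omega>) \<and>
            min_planar_cost d n (\<lambda>i. C n i \<omega>) \<le> 49 * exp 1 ^ (d - 1) * ln (real n) / real n ^ (d - 2)}"
  let ?err = "\<lambda>n. exp (- 1) ^ n + (2 * (exp ((sqrt (ln (real n)) + 1) / ln (real n)) - 1)
      + 6 * ln (real n) * (1 / 4) powr sqrt (ln (real n)))"
  \<comment> \<open>The exponent \<open>(sqrt (ln n) + 1) / ln n\<close> tends to 0, and
    \<open>(1 / 4) powr sqrt (ln n)\<close> decays faster than \<open>ln n\<close> grows.\<close>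
  have "(\<lambda>n. 1 - ?err n) \<longlonglongrightarrow> 1" by real_asymp
  moreover have "eventually (\<lambda>n. 1 - ?err n \<le> ?P n) sequentially"
    using arr assms by (intro eventually_sequentiallyI[of 3] min_planar_cost_concentration) auto
  moreover have "eventually (\<lambda>n. ?P n \<le> 1) sequentially"
    using arr by (intro eventually_sequentiallyI[of 1] prob_space.prob_le_1) (auto simp: exponential_array_def)
  ultimately show "?P \<longlonglongrightarrow> 1"
    by (rule tendsto_sandwich[OF _ _ _ tendsto_const, rotated 2])
qed simp

end
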